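(* The Hill-Climbing algorithm described in the context converges: for every finite data set $\widehat{\mathcal{X}}=\{(x_i,y_i)\}_{i\in[m]}$, every choice of feature subsets $F_1,\dots,F_n\subseteq F$, every nonempty hypothesis space $\mathcal{H}$ (with access to an exact empirical risk minimization oracle for it), every initialization $f_1^0,\dots,f_n^0\in\mathcal{H}$ and every choice of minimizers in its update steps, the while-loop of the algorithm terminates after finitely many iterations.
   Context: There are $k$ features, indexed by $F=[k]=\{1,\dots,k\}$. Each data point $x$ in the input space $\mathcal{X}$ has for each $i\in[k]$ a feature value $x_i$, where $x_i=*$ means that $x$ does not have feature $i$. For $S\subseteq[k]$, $x|_S\in\mathcal{X}$ is defined by $(x|_S)_i=x_i$ if $i\in S$ and $(x|_S)_i=*$ otherwise. A classifier is a function $f:\mathcal{X}\to\{0,1\}$; $\mathcal{H}$ is a set of classifiers. Labels $y_i$ lie in $\{0,1\}$. A subclassifier $f_j\in\mathcal{H}$ attached to the feature subset $F_j$ is applied to $x$ through $f_j(x|_{F_j})$, with the convention that this value is $0$ (automatic rejection) if $x$ lacks some feature in $F_j$. The Max Ensemble $\textsc{Max}_{\{f_1,\dots,f_n\}}$ is the classifier $x\mapsto\max_j f_j(x|_{F_j})$. The empirical loss is $\ell_{\widehat{\mathcal{X}}}(f)=\frac1m\sum_{i\in[m]}|f(x_i)-y_i|$. Hill-Climbing algorithm. Input: data set $\widehat{\mathcal{X}}=\{(x_i,y_i)\}_{i\in[m]}$ and $n$ subsets $F_1,\dots,F_n$ of $F$. Initialize $t\leftarrow0$ and $f_1^0,\dots,f_n^0\in\mathcal{H}$;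 the loop is entered at least once (put $\ell_{-1}=+\infty$). While $\Delta>0$, do: (1) for each $i=1,\dots,n$: let $S_i=\{(x,y)\in\widehat{\mathcal{X}}: f_j^t(x|_{F_j})=0\ \text{for all } j\neq i\}$ and let $f_i^{t+1}\in\operatorname{argmin}_{f\in\mathcal{H}}\sum_{(x,y)\in S_i}|f(x|_{F_i})-y|$ (any minimizer, provided by the oracle); (2) let $f^*\leftarrow\textsc{Max}_{\{f_1^{t+1},\dots,f_n^{t+1}\}}$ and $\ell_t=\ell_{\widehat{\mathcal{X}}}(f^* )$; (3) let $\Delta\leftarrow\ell_{t-1}-\ell_t$ (the decrease in empirical loss) and $t\leftarrow t+1$. Return $f^*$. *)

theory Defs
  imports "HOL-Library.FuncSet" "HOL-Library.Extended_Real"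
begin

(* A data point assigns to feature i either None (the point lacks feature i, written "*" on
   paper) or Some value.  The restriction of x to S is then the library's restrict_map, written
   x |` S, and dom x is the set of features that x has. *)
type_synonym 'v point = "nat \<Rightarrow> 'v option"

type_synonym 'v classifier = "'v point \<Rightarrow> real"

definition input_space :: "nat \<Rightarrow> 'v point set \<Rightarrow> bool" where
  "input_space k X \<longleftrightarrow> (\<forall>x\<in>X. dom x \<subseteq> {1..k} \<and> (\<forall>S. S \<subseteq> {1..k} \<longrightarrow> x |` S \<in> X))"

(* Functions are total in HOL; the values of a classifier outside X are irrelevant. *)
definition classifiers :: "'v point set \<Rightarrow> 'v classifier set" where
  "classifiers X = X \<rightarrow> {0, 1}"

(* The value f(x|_S) of a subclassifier attached to S, with automatic rejection. *)
definition sub_value :: "'v classifier \<Rightarrow> nat set \<Rightarrow> 'v point \<Rightarrow> real" where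
  "sub_value f S x = (if S \<subseteq> dom x then f (x |` S) else 0)"

(* For n = 0 this is the constant function with value Max {}, an unspecified real number. *)
definition max_ensemble :: "nat \<Rightarrow> (nat \<Rightarrow> nat set) \<Rightarrow> (nat \<Rightarrow> 'v classifier) \<Rightarrow> 'v classifier" where
  "max_ensemble n F f = (\<lambda>x. Max ((\<lambda>j. sub_value (f j) (F j) x) ` {1..n}))"

(* The loss is 0 for m = 0, by the convention on division by 0. *)
definition empirical_loss ::
  "nat \<Rightarrow> (nat \<Rightarrow> 'v point) \<Rightarrow> (nat \<Rightarrow> real) \<Rightarrow> 'v classifier \<Rightarrow> real" where
  "empirical_loss m x y f = 1 / real m * (\<Sum>i\<in>{1..m}. \<bar>f (x i) - y i\<bar>)"

(* The set S_i, as a set of indices of data items, so that repeated items keep their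
   multiplicity, as in the empirical loss. *)
definition rejected_by_others ::
  "nat \<Rightarrow> (nat \<Rightarrow> 'v point) \<Rightarrow> nat \<Rightarrow> (nat \<Rightarrow> nat set) \<Rightarrow> (nat \<Rightarrow> 'v classifier) \<Rightarrow> nat \<Rightarrow> nat set" where
  "rejected_by_others m x n F f i =
     {l \<in> {1..m}. \<forall>j\<in>{1..n}. j \<noteq> i \<longrightarrow> sub_value (f j) (F j) (x l) = 0}"

(* State of the program at the loop test: the current subclassifiers, the loss computed in the
   last iteration (infinite before the first one) and the variable Delta.  The counter t is the
   position in a run, and the returned classifier is max_ensemble n F of the field subs. *)
record 'v hc_state =
  subs :: "nat \<Rightarrow> 'v classifier"
  last_loss :: ereal
  Delta :: ereal

(* Delta > 0 initially expresses that the loop is entered at least once. *)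
definition hc_init :: "'v classifier set \<Rightarrow> nat \<Rightarrow> 'v hc_state \<Rightarrow> bool" where
  "hc_init H n s \<longleftrightarrow> (\<forall>i\<in>{1..n}. subs s i \<in> H) \<and> last_loss s = \<infinity> \<and> Delta s > 0"

(* A relation, because any minimizer may be returned by the oracle.  All the updates in one
   execution of the body refer to the old subclassifiers subs s. *)
definition hc_body ::
  "'v classifier set \<Rightarrow> nat \<Rightarrow> (nat \<Rightarrow> 'v point) \<Rightarrow> (nat \<Rightarrow> real) \<Rightarrow> nat \<Rightarrow> (nat \<Rightarrow> nat set)
     \<Rightarrow> 'v hc_state \<Rightarrow> 'v hc_state \<Rightarrow> bool" where
  "hc_body H m x y n F s s' \<longleftrightarrow>
     (\<forall>i\<in>{1..n}.
        is_arg_min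
          (\<lambda>f. \<Sum>l\<in>rejected_by_others m x n F (subs s) i. \<bar>sub_value f (F i) (x l) - y l\<bar>)
          (\<lambda>f. f \<in> H) (subs s' i)) \<and>
     last_loss s' = ereal (empirical_loss m x y (max_ensemble n F (subs s'))) \<and>
     Delta s' = last_loss s - last_loss s'"

definition hc_step ::
  "'v classifier set \<Rightarrow> nat \<Rightarrow> (nat \<Rightarrow> 'v point) \<Rightarrow> (nat \<Rightarrow> real) \<Rightarrow> nat \<Rightarrow> (nat \<Rightarrow> nat set)
     \<Rightarrow> 'v hc_state \<Rightarrow> 'v hc_state \<Rightarrow> bool" where
  "hc_step H m x y n F s s' \<longleftrightarrow> Delta s > 0 \<and> hc_body H m x y n F s s'"

(* Termination of a nondeterministic loop: no infinite run, and no run gets stuck before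
   the loop test fails. *)
definition hc_terminates_from ::
  "'v classifier set \<Rightarrow> nat \<Rightarrow> (nat \<Rightarrow> 'v point) \<Rightarrow> (nat \<Rightarrow> real) \<Rightarrow> nat \<Rightarrow> (nat \<Rightarrow> nat set)
     \<Rightarrow> 'v hc_state \<Rightarrow> bool" where
  "hc_terminates_from H m x y n F s0 \<longleftrightarrow>
     (\<nexists>s. s 0 = s0 \<and> (\<forall>t::nat. hc_step H m x y n F (s t) (s (Suc t)))) \<and>
     (\<forall>s. (hc_step H m x y n F)\<^sup>*\<^sup>* s0 s \<and> Delta s > 0 \<longrightarrow> (\<exists>s'. hc_step H m x y n F s s'))"

end

theory Submission
  imports Defs
begin

text \<open>The loss sees an ensemble only through its values at the \<open>m\<close> data points.
  These values lie in a fixed finite set, so only finitely many losses can occur, even if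
  \<open>H\<close> is infinite (\<open>finite_range_empirical_loss\<close>). As long as the loop
  test succeeds, the loss has strictly decreased, and a strictly decreasing sequence cannot stay in
  a finite set (\<open>hc_no_infinite_run\<close>). Nor can a run get stuck: each oracle objective
  also takes finitely many values, hence attains its minimum on the nonempty \<open>H\<close>
  (\<open>hc_body_total\<close>).\<close>

text \<open>The sum depends on \<open>a\<close> only through the restriction of \<open>g a\<close>
  to \<open>I\<close>, one of the finitely many extensional functions from \<open>I\<close> to
  \<open>B\<close>. This covers both the loss and the oracle objectives.\<close>

lemma finite_range_sum:
  fixes h :: "'i \<Rightarrow> 'b \<Rightarrow> 'c::comm_monoid_add"
  assumes "finite I" "finite B" "\<And>a i. a \<in> A \<Longrightarrow> i \<in> I \<Longrightarrow> g a i \<in> B"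
  shows "finite ((\<lambda>a. \<Sum>i\<in>I. h i (g a i)) ` A)"
proof (rule finite_subset)
  show "(\<lambda>a. \<Sum>i\<in>I. h i (g a i)) ` A \<subseteq> (\<lambda>v. \<Sum>i\<in>I. h i (v i)) ` (I \<rightarrow>\<^sub>E B)"
  proof
    fix z assume "z \<in> (\<lambda>a. \<Sum>i\<in>I. h i (g a i)) ` A"
    then obtain a where "a \<in> A" "z = (\<Sum>i\<in>I. h i (g a i))" by blast
    then have "z = (\<Sum>i\<in>I. h i (restrict (g a) I i))" "restrict (g a) I \<in> I \<rightarrow>\<^sub>E B"
      using assms(3) by auto
    then show "z \<in> (\<lambda>v. \<Sum>i\<in>I. h i (v i)) ` (I \<rightarrow>\<^sub>E B)" by blast
  qed
  show "finite ((\<lambda>v. \<Sum>i\<in>I. h i (v i)) ` (I \<rightarrow>\<^sub>E B))"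
    using assms(1,2) by (simp add: finite_PiE)
qed

text \<open>\<open>A\<close> itself may be infinite; a finite nonempty set of values already
  contains its minimum.\<close>

lemma ex_is_arg_min_if_finite_range:
  fixes c :: "'a \<Rightarrow> 'b::linorder"
  assumes "finite (c ` A)" "A \<noteq> {}"
  shows "\<exists>a. is_arg_min c (\<lambda>a. a \<in> A) a"
proof -
  have "Min (c ` A) \<in> c ` A" using assms by simp
  then obtain a where "a \<in> A" "c a = Min (c ` A)" by auto
  then have "is_arg_min c (\<lambda>a. a \<in> A) a" using assms(1) by (simp add: is_arg_min_linorder)
  then show ?thesis by blast
qed

lemma no_infinite_descent_in_finite:
  fixes u :: "nat \<Rightarrow> 'a::order"
  assumes "finite A" "\<And>t. u t \<in> A" "\<And>t. u (Suc t) < u t"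
  shows False
proof -
  have "u t < u s" if "s < t" for s t
    using that
  proof (induction rule: less_Suc_induct)
    case (1 i)
    show ?case by (rule assms(3))
  next
    case (2 i j l)
    then show ?case by order
  qed
  \<comment> \<open>Strict monotonicity makes all values distinct, so the range is infinite, yet it
    is contained in \<open>A\<close>.\<close>
  then have "inj u" by (metis injI less_irrefl nat_neq_iff)
  then have "infinite (range u)" by (rule range_inj_infinite)
  then show False using assms(1,2) by (meson finite_subset image_subsetI)
qed

lemma sub_value_range:
  assumes "input_space k X" "f \<in> classifiers X" "S \<subseteq> {1..k}" "p \<in> X"
  shows "sub_value f S p \<in> {0, 1}"
  using assms unfolding sub_value_def classifiers_def input_space_def by (auto simp: Pi_iff)

text \<open>The maximum is one of the subclassifier values, which are binary. The extra element
  \<open>Max {}\<close> accounts for \<open>n = 0\<close>; the set stays finite and independent of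
  \<open>f\<close> and \<open>p\<close>.\<close>

lemma max_ensemble_range:
  assumes "input_space k X" "\<And>j. j \<in> {1..n} \<Longrightarrow> f j \<in> classifiers X"
    and "\<And>j. j \<in> {1..n} \<Longrightarrow> F j \<subseteq> {1..k}" "p \<in> X"
  shows "max_ensemble n F f p \<in> {0, 1, Max {}}"
proof (cases "n = 0")
  case True
  then show ?thesis by (simp add: max_ensemble_def)
next
  case False
  then have "max_ensemble n F f p \<in> (\<lambda>j. sub_value (f j) (F j) p) ` {1..n}"
    unfolding max_ensemble_def by (intro Max_in) auto
  moreover have "(\<lambda>j. sub_value (f j) (F j) p) ` {1..n} \<subseteq> {0, 1}"
    using sub_value_range[OF assms(1) assms(2) assms(3) assms(4)] by blast
  ultimately show ?thesis by auto
qed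

lemma finite_range_empirical_loss:
  assumes "input_space k X" "H \<subseteq> classifiers X"
    and "\<And>i. i \<in> {1..m} \<Longrightarrow> x i \<in> X" "\<And>j. j \<in> {1..n} \<Longrightarrow> F j \<subseteq> {1..k}"
  shows "finite ((\<lambda>f. empirical_loss m x y (max_ensemble n F f)) ` {f. \<forall>i\<in>{1..n}. f i \<in> H})"
proof -
  have "finite ((\<lambda>f. \<Sum>i\<in>{1..m}. \<bar>max_ensemble n F f (x i) - y i\<bar>) ` {f. \<forall>i\<in>{1..n}. f i \<in> H})"
  proof (rule finite_range_sum[where h = "\<lambda>i v. \<bar>v - y i\<bar>"])
    show "max_ensemble n F f (x i) \<in> {0, 1, Max {}}"
      if "f \<in> {f. \<forall>i\<in>{1..n}. f i \<in> H}" "i \<in> {1..m}" for f i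
      using that assms by (intro max_ensemble_range[where k = k and X = X]) auto
  qed auto
  then have "finite ((\<lambda>v. 1 / real m * v) `
      (\<lambda>f. \<Sum>i\<in>{1..m}. \<bar>max_ensemble n F f (x i) - y i\<bar>) ` {f. \<forall>i\<in>{1..n}. f i \<in> H})"
    by (rule finite_imageI)
  then show ?thesis by (simp add: image_image empirical_loss_def)
qed

text \<open>All updates read the old subclassifiers, so the \<open>n\<close> minimization problems
  are independent and their solutions can be chosen separately. The state \<open>s\<close> is
  arbitrary, so reachable states are covered.\<close>

lemma hc_body_total:
  assumes "input_space k X" "H \<subseteq> classifiers X" "H \<noteq> {}"
    and "\<And>i. i \<in> {1..m} \<Longrightarrow> x i \<in> X" "\<And>j. j \<in> {1..n} \<Longrightarrow> F j \<subseteq> {1..k}"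
  shows "\<exists>s'. hc_body H m x y n F s s'"
proof -
  let ?R = "\<lambda>i. rejected_by_others m x n F (subs s) i"
  let ?c = "\<lambda>i f. \<Sum>l\<in>?R i. \<bar>sub_value f (F i) (x l) - y l\<bar>"
  have "\<exists>f. is_arg_min (?c i) (\<lambda>f. f \<in> H) f" if i: "i \<in> {1..n}" for i
  proof (rule ex_is_arg_min_if_finite_range)
    show "finite (?c i ` H)"
    proof (rule finite_range_sum[where h = "\<lambda>l v. \<bar>v - y l\<bar>"])
      show "sub_value f (F i) (x l) \<in> {0, 1}" if "f \<in> H" "l \<in> ?R i" for f l
        using that i assms
        by (intro sub_value_range[where k = k and X = X]) (auto simp: rejected_by_others_def)
    qed (auto simp: rejected_by_others_def)
  qed (fact assms(3))
  then obtain g where g: "\<forall>i\<in>{1..n}. is_arg_min (?c i) (\<lambda>f. f \<in> H) (g i)"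
    using bchoice[of "{1..n}" "\<lambda>i f. is_arg_min (?c i) (\<lambda>f. f \<in> H) f"] by blast
  define L where "L = ereal (empirical_loss m x y (max_ensemble n F g))"
  have "hc_body H m x y n F s \<lparr>subs = g, last_loss = L, Delta = last_loss s - L\<rparr>"
    using g by (simp add: hc_body_def L_def)
  then show ?thesis by blast
qed

lemma hc_no_infinite_run:
  assumes "input_space k X" "H \<subseteq> classifiers X"
    and "\<And>i. i \<in> {1..m} \<Longrightarrow> x i \<in> X" "\<And>j. j \<in> {1..n} \<Longrightarrow> F j \<subseteq> {1..k}"
    and run: "\<And>t. hc_step H m x y n F (s t) (s (Suc t))"
  shows False
proof -
  \<comment> \<open>The loss of the initial state may be infinite, hence the shift by one step.\<close>
  define u where "u t = empirical_loss m x y (max_ensemble n F (subs (s (Suc t))))" for t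
  have loss: "last_loss (s (Suc t)) = ereal (u t)" for t
    using run[of t] by (simp add: hc_step_def hc_body_def u_def)
  \<comment> \<open>A minimizer over \<open>H\<close> is in particular a member of
    \<open>H\<close>.\<close>
  have subs: "subs (s (Suc t)) \<in> {f. \<forall>i\<in>{1..n}. f i \<in> H}" for t
    using run[of t] by (simp add: hc_step_def hc_body_def is_arg_min_def)
  have "finite ((\<lambda>f. empirical_loss m x y (max_ensemble n F f)) `
      {f. \<forall>i\<in>{1..n}. f i \<in> H})"
    using assms(1-4) by (rule finite_range_empirical_loss)
  moreover have "u t \<in> (\<lambda>f. empirical_loss m x y (max_ensemble n F f)) ` {f. \<forall>i\<in>{1..n}. f i \<in> H}" for t
    unfolding u_def using subs by (rule imageI)
  moreover have "u (Suc t) < u t" for t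
  proof -
    have "Delta (s (Suc (Suc t))) = last_loss (s (Suc t)) - last_loss (s (Suc (Suc t)))"
      using run[of "Suc t"] by (simp add: hc_step_def hc_body_def)
    \<comment> \<open>In an infinite run the next step is also taken, so the loop test succeeds in
      this state. Both losses in the difference are finite by \<open>loss\<close>, so its positivity
      is a strict inequality between reals.\<close>
    moreover have "Delta (s (Suc (Suc t))) > 0"
      using run[of "Suc (Suc t)"] by (simp add: hc_step_def)
    ultimately show ?thesis by (simp add: loss)
  qed
  ultimately show False
    by (rule no_infinite_descent_in_finite[where u = u])
qed

theorem theorem4:
  fixes k m n :: nat
    and X :: "'v point set"
    and H :: "'v classifier set"
    and x :: "nat \<Rightarrow> 'v point"
    and y :: "nat \<Rightarrow> real"
    and F :: "nat \<Rightarrow> nat set"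
    and s0 :: "'v hc_state"
  assumes "input_space k X"
    and "H \<subseteq> classifiers X"
    and "H \<noteq> {}"
    and "\<And>i. i \<in> {1..m} \<Longrightarrow> x i \<in> X"
    and "\<And>i. i \<in> {1..m} \<Longrightarrow> y i \<in> {0, 1}"
    and "\<And>j. j \<in> {1..n} \<Longrightarrow> F j \<subseteq> {1..k}"
    and "hc_init H n s0"
  shows "hc_terminates_from H m x y n F s0"
  unfolding hc_terminates_from_def
proof (intro conjI allI impI)
  show "\<nexists>s. s 0 = s0 \<and> (\<forall>t. hc_step H m x y n F (s t) (s (Suc t)))"
  proof safe
    fix s
    assume "\<forall>t. hc_step H m x y n F (s t) (s (Suc t))"
    then have "hc_step H m x y n F (s t) (s (Suc t))" for t by blast
    with assms(1,2,4,6) show False by (rule hc_no_infinite_run)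
  qed
next
  fix s
  assume "(hc_step H m x y n F)\<^sup>*\<^sup>* s0 s \<and> Delta s > 0"
  moreover have "\<exists>s'. hc_body H m x y n F s s'"
    using assms(1,2,3,4,6) by (rule hc_body_total)
  ultimately show "\<exists>s'. hc_step H m x y n F s s'"
    by (simp add: hc_step_def)
qed

end
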